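(* Suppose that $(S,\circ)$ is a graded anti-pre-Lie algebraic structure on the Witt algebra $\mathcal{W}$, with $W_m\circ W_n=\varphi(m,n)W_{m+n}$ for all $m,n\in\mathbb{Z}$. Define a linear map $\rho:\mathcal{W}\to\mathfrak{gl}(S)$ by $$\rho(W_m)W_n=-W_m\circ W_n=-\varphi(m,n)W_{m+n},\qquad\forall m,n\in\mathbb{Z}.$$ Then $(\rho,S)$ is an indecomposable representation of $\mathcal{W}$. Moreover, $(\rho,S)$ is isomorphic, as a representation of $\mathcal{W}$, to one of the representations $V_\alpha$ ($\alpha\in\mathbb{C}$), $V^\beta$ ($\beta\in\mathbb{C}$), $V_{\alpha,\beta}$ ($\alpha,\beta\in\mathbb{C}$, $0\le\mathrm{Re}\,\alpha<1$).
   Context: All vector spaces and algebras are over $\mathbb{C}$. An anti-pre-Lie algebra is a vector space $A$ with a bilinear operation $\circ$ such that, with $[x,y]=x\circ y-y\circ x$, for all $x,y,z\in A$: $x\circ(y\circ z)-y\circ(x\circ z)=[y,x]\circ z$ and $[[x,y],z]+[[y,z],x]+[[z,x],y]=0$. The commutator $[\cdot,\cdot]$ then is a Lie bracket on $A$, and $(A,\circ)$ is called an anti-pre-Lie algebraic structure on a Lie algebra $\mathfrak{g}$ if the underlying vector space of $\mathfrak g$ is $A$ and the Lie bracket of $\mathfrak g$ is this commutator. The Witt algebra $\mathcal{W}$ is the Lie algebra with basis $\{W_m : m\in\mathbb{Z}\}$ and bracket $[W_m,W_n]=(n-m)W_{m+n}$ for all $m,n\in\mathbb{Z}$. A graded anti-pre-Lie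 algebraic structure on $\mathcal{W}$, denoted $(S,\circ)$, is an anti-pre-Lie algebraic structure on $\mathcal{W}$ (so $S=\mathcal{W}$ as a vector space) such that $W_m\circ W_n=\varphi(m,n)W_{m+n}$ for all $m,n\in\mathbb{Z}$, for some function $\varphi:\mathbb{Z}\times\mathbb{Z}\to\mathbb{C}$. A representation is indecomposable if it cannot be decomposed into a direct sum of two proper subrepresentations. On the vector space $V=\bigoplus_{i\in\mathbb{Z}}\mathbb{C}v_i$ one has the following representations of $\mathcal{W}$: (1) for $\alpha\in\mathbb{C}$, $V_\alpha$: $W_mv_i=(m+i)v_{m+i}$ for $m\in\mathbb{Z}$, $i\in\mathbb{Z}\setminus\{0\}$, and $W_mv_0=m(\alpha+m)v_m$ for $m\in\mathbb{Z}$; (2) for $\beta\in\mathbb{C}$, $V^\beta$: $W_mv_i=iv_{m+i}$ for $m,i\in\mathbb{Z}$ with $m+i\neq0$, and $W_iv_{-i}=-i(\beta+i)v_0$ for $i\in\mathbb{Z}$; (3) for $\alpha,\beta\in\mathbb{C}$ with $0\le\mathrm{Re}\,\alpha<1$, $V_{\alpha,\beta}$: $W_mv_i=(\alpha+i+m\beta)v_{m+i}$ for $m,i\in\mathbb{Z}$. *)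

theory Defs
  imports Complex_Main "HOL-Library.Poly_Mapping"
begin

section \<open>Complex vector spaces, Lie algebras and their representations\<close>

text \<open>
  A complex vector space is a whole type \<open>'v\<close> together with a scalar multiplication
  \<open>s :: complex \<Rightarrow> 'v \<Rightarrow> 'v\<close> satisfying \<open>vector_space s\<close>. A linear map from \<open>'g\<close> to
  \<open>\<gg>\<ll>('v)\<close>, like a bilinear operation, is given in curried form.
\<close>

definition bilinear_map ::
  "(complex \<Rightarrow> 'a::ab_group_add \<Rightarrow> 'a) \<Rightarrow> (complex \<Rightarrow> 'b::ab_group_add \<Rightarrow> 'b) \<Rightarrow>
   (complex \<Rightarrow> 'c::ab_group_add \<Rightarrow> 'c) \<Rightarrow> ('a \<Rightarrow> 'b \<Rightarrow> 'c) \<Rightarrow> bool"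
  where "bilinear_map s1 s2 s3 f \<longleftrightarrow>
    (\<forall>y. Vector_Spaces.linear s1 s3 (\<lambda>x. f x y)) \<and> (\<forall>x. Vector_Spaces.linear s2 s3 (f x))"

definition lie_algebra ::
  "(complex \<Rightarrow> 'g::ab_group_add \<Rightarrow> 'g) \<Rightarrow> ('g \<Rightarrow> 'g \<Rightarrow> 'g) \<Rightarrow> bool"
  where "lie_algebra s br \<longleftrightarrow> bilinear_map s s s br \<and> (\<forall>x. br x x = 0) \<and>
    (\<forall>x y z. br (br x y) z + br (br y z) x + br (br z x) y = 0)"

definition anti_pre_lie_algebra ::
  "(complex \<Rightarrow> 'a::ab_group_add \<Rightarrow> 'a) \<Rightarrow> ('a \<Rightarrow> 'a \<Rightarrow> 'a) \<Rightarrow> bool"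
  where "anti_pre_lie_algebra s circ \<longleftrightarrow> bilinear_map s s s circ \<and>
    (let br = (\<lambda>x y. circ x y - circ y x) in
      (\<forall>x y z. circ x (circ y z) - circ y (circ x z) = circ (br y x) z) \<and>
      (\<forall>x y z. br (br x y) z + br (br y z) x + br (br z x) y = 0))"

definition anti_pre_lie_structure_on ::
  "(complex \<Rightarrow> 'g::ab_group_add \<Rightarrow> 'g) \<Rightarrow> ('g \<Rightarrow> 'g \<Rightarrow> 'g) \<Rightarrow> ('g \<Rightarrow> 'g \<Rightarrow> 'g) \<Rightarrow> bool"
  where "anti_pre_lie_structure_on s br circ \<longleftrightarrow>
    anti_pre_lie_algebra s circ \<and> (\<forall>x y. br x y = circ x y - circ y x)"

definition lie_rep ::
  "(complex \<Rightarrow> 'g::ab_group_add \<Rightarrow> 'g) \<Rightarrow> ('g \<Rightarrow> 'g \<Rightarrow> 'g) \<Rightarrow>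
   (complex \<Rightarrow> 'v::ab_group_add \<Rightarrow> 'v) \<Rightarrow> ('g \<Rightarrow> 'v \<Rightarrow> 'v) \<Rightarrow> bool"
  where "lie_rep sg br sv \<rho> \<longleftrightarrow> bilinear_map sg sv sv \<rho> \<and>
    (\<forall>x y v. \<rho> (br x y) v = \<rho> x (\<rho> y v) - \<rho> y (\<rho> x v))"

definition subrep ::
  "(complex \<Rightarrow> 'v::ab_group_add \<Rightarrow> 'v) \<Rightarrow> ('g \<Rightarrow> 'v \<Rightarrow> 'v) \<Rightarrow> 'v set \<Rightarrow> bool"
  where "subrep sv \<rho> U \<longleftrightarrow> module.subspace sv U \<and> (\<forall>x. \<forall>u\<in>U. \<rho> x u \<in> U)"

definition indecomposable_rep ::
  "(complex \<Rightarrow> 'v::ab_group_add \<Rightarrow> 'v) \<Rightarrow> ('g \<Rightarrow> 'v \<Rightarrow> 'v) \<Rightarrow> bool"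
  where "indecomposable_rep sv \<rho> \<longleftrightarrow>
    \<not> (\<exists>U1 U2. subrep sv \<rho> U1 \<and> subrep sv \<rho> U2 \<and> U1 \<noteq> UNIV \<and> U2 \<noteq> UNIV \<and>
          U1 \<inter> U2 = {0} \<and> {u1 + u2 | u1 u2. u1 \<in> U1 \<and> u2 \<in> U2} = UNIV)"

definition rep_isomorphic ::
  "(complex \<Rightarrow> 'v::ab_group_add \<Rightarrow> 'v) \<Rightarrow> ('g \<Rightarrow> 'v \<Rightarrow> 'v) \<Rightarrow>
   (complex \<Rightarrow> 'w::ab_group_add \<Rightarrow> 'w) \<Rightarrow> ('g \<Rightarrow> 'w \<Rightarrow> 'w) \<Rightarrow> bool"
  where "rep_isomorphic sv \<rho> sw \<sigma> \<longleftrightarrow>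
    (\<exists>f. Vector_Spaces.linear sv sw f \<and> bij f \<and> (\<forall>x v. f (\<rho> x v) = \<sigma> x (f v)))"


section \<open>Graded bilinear maps on the complex vector space with a basis indexed by the integers\<close>

type_synonym zvec = "int \<Rightarrow>\<^sub>0 complex"

definition zscale :: "complex \<Rightarrow> zvec \<Rightarrow> zvec"
  where "zscale c = Poly_Mapping.map ((*) c)"

definition bas :: "int \<Rightarrow> zvec"
  where "bas m = Poly_Mapping.single m 1"

text \<open>
  The bilinear map sending \<open>(bas m, bas i)\<close> to \<open>c m i\<close> times \<open>bas (m + i)\<close>; see
  \<open>bilinear_graded_map\<close> and \<open>graded_map_bas\<close> below.
\<close>

definition graded_map :: "(int \<Rightarrow> int \<Rightarrow> complex) \<Rightarrow> zvec \<Rightarrow> zvec \<Rightarrow> zvec"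
  where "graded_map c x v =
    (\<Sum>m\<in>Poly_Mapping.keys x. \<Sum>i\<in>Poly_Mapping.keys v.
       Poly_Mapping.single (m + i) (Poly_Mapping.lookup x m * Poly_Mapping.lookup v i * c m i))"

lemma lookup_zscale [simp]: "Poly_Mapping.lookup (zscale c x) k = c * Poly_Mapping.lookup x k"
  unfolding zscale_def by (simp add: Poly_Mapping.map.rep_eq when_def)

lemma vector_space_zscale: "vector_space zscale"
  by unfold_locales (auto intro!: poly_mapping_eqI simp: lookup_add algebra_simps)

lemma graded_map_superset:
  assumes "finite A" "finite B" "Poly_Mapping.keys x \<subseteq> A" "Poly_Mapping.keys v \<subseteq> B"
  shows "graded_map c x v =
    (\<Sum>m\<in>A. \<Sum>i\<in>B. Poly_Mapping.single (m + i) (Poly_Mapping.lookup x m * Poly_Mapping.lookup v i * c m i))"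
proof -
  have "graded_map c x v =
    (\<Sum>m\<in>Poly_Mapping.keys x. \<Sum>i\<in>B. Poly_Mapping.single (m + i) (Poly_Mapping.lookup x m * Poly_Mapping.lookup v i * c m i))"
    unfolding graded_map_def using assms
    by (intro sum.cong sum.mono_neutral_left) (auto simp: in_keys_iff)
  also have "\<dots> = (\<Sum>m\<in>A. \<Sum>i\<in>B. Poly_Mapping.single (m + i) (Poly_Mapping.lookup x m * Poly_Mapping.lookup v i * c m i))"
    using assms by (intro sum.mono_neutral_left) (auto simp: in_keys_iff)
  finally show ?thesis .
qed

lemma graded_map_add_left: "graded_map c (x + y) v = graded_map c x v + graded_map c y v"
proof -
  let ?A = "Poly_Mapping.keys x \<union> Poly_Mapping.keys y" and ?B = "Poly_Mapping.keys v"
  show ?thesis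
    using Poly_Mapping.keys_add[of x y]
    by (simp add: graded_map_superset[of ?A ?B] lookup_add algebra_simps single_add sum.distrib)
qed

lemma graded_map_add_right: "graded_map c x (v + w) = graded_map c x v + graded_map c x w"
proof -
  let ?A = "Poly_Mapping.keys x" and ?B = "Poly_Mapping.keys v \<union> Poly_Mapping.keys w"
  show ?thesis
    using Poly_Mapping.keys_add[of v w]
    by (simp add: graded_map_superset[of ?A ?B] lookup_add algebra_simps single_add sum.distrib)
qed

lemma keys_zscale: "Poly_Mapping.keys (zscale a x) \<subseteq> Poly_Mapping.keys x"
  by (auto simp: in_keys_iff)

lemma zscale_sum: "zscale a (\<Sum>i\<in>A. f i) = (\<Sum>i\<in>A. zscale a (f i))"
  by (intro poly_mapping_eqI) (simp add: lookup_sum sum_distrib_left)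

lemma zscale_single: "zscale a (Poly_Mapping.single k b) = Poly_Mapping.single k (a * b)"
  by (intro poly_mapping_eqI) (simp add: lookup_single when_def)

lemma graded_map_scale_left: "graded_map c (zscale a x) v = zscale a (graded_map c x v)"
  using graded_map_superset[of "Poly_Mapping.keys x" "Poly_Mapping.keys v" "zscale a x" v c]
  by (simp add: keys_zscale graded_map_def zscale_sum zscale_single mult_ac)

lemma graded_map_scale_right: "graded_map c x (zscale a v) = zscale a (graded_map c x v)"
  using graded_map_superset[of "Poly_Mapping.keys x" "Poly_Mapping.keys v" x "zscale a v" c]
  by (simp add: keys_zscale graded_map_def zscale_sum zscale_single mult_ac)

lemma bilinear_graded_map: "bilinear_map zscale zscale zscale (graded_map c)"
  unfolding bilinear_map_def Vector_Spaces.linear_def module_hom_def module_hom_axioms_def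
  using vector_space_zscale
  by (simp add: graded_map_add_left graded_map_add_right graded_map_scale_left
        graded_map_scale_right module_iff_vector_space)

lemma graded_map_bas: "graded_map c (bas m) (bas i) = zscale (c m i) (bas (m + i))"
  by (simp add: graded_map_def bas_def zscale_single)

lemma zvec_induct [case_names zero bas add scale]:
  assumes "P 0" and bas: "\<And>k. P (bas k)"
    and add: "\<And>x y. P x \<Longrightarrow> P y \<Longrightarrow> P (x + y)" and scale: "\<And>c x. P x \<Longrightarrow> P (zscale c x)"
  shows "P x"
proof (induction x rule: update_induct)
  case (update f a b)
  have "Poly_Mapping.update a b f = f + zscale b (bas a)"
    using update(1) by (intro poly_mapping_eqI)
      (auto simp: lookup_update lookup_add bas_def lookup_single when_def in_keys_iff)
  then show ?case using update add scale bas by metis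
qed (fact assms(1))


section \<open>The Witt algebra and three families of representations\<close>

text \<open>
  The underlying space of the Witt algebra is \<^typ>\<open>zvec\<close>, with \<open>W\<^sub>m = bas m\<close>. The same space,
  with \<open>v\<^sub>i = bas i\<close>, carries the representations.
\<close>

definition witt_bracket :: "zvec \<Rightarrow> zvec \<Rightarrow> zvec"
  where "witt_bracket = graded_map (\<lambda>m n. of_int (n - m))"

definition V_lower :: "complex \<Rightarrow> zvec \<Rightarrow> zvec \<Rightarrow> zvec"
  where "V_lower \<alpha> = graded_map (\<lambda>m i.
    if i = 0 then of_int m * (\<alpha> + of_int m) else of_int (m + i))"

definition V_upper :: "complex \<Rightarrow> zvec \<Rightarrow> zvec \<Rightarrow> zvec"
  where "V_upper \<beta> = graded_map (\<lambda>m i.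
    if m + i = 0 then - of_int m * (\<beta> + of_int m) else of_int i)"

definition V_two :: "complex \<Rightarrow> complex \<Rightarrow> zvec \<Rightarrow> zvec \<Rightarrow> zvec"
  where "V_two \<alpha> \<beta> = graded_map (\<lambda>m i. \<alpha> + of_int i + of_int m * \<beta>)"

lemma graded_map_zero [simp]: "graded_map c 0 v = 0" "graded_map c x 0 = 0"
  by (simp_all add: graded_map_def)

lemma zscale_simps:
  "zscale a (x + y) = zscale a x + zscale a y" "zscale a (x - y) = zscale a x - zscale a y"
  "zscale a (zscale b x) = zscale (a * b) x" "zscale a 0 = 0"
  by (rule poly_mapping_eqI, simp add: lookup_add lookup_minus distrib_left right_diff_distrib)+

lemma zscale_diff_left: "zscale a x - zscale b x = zscale (a - b) x"
  by (rule poly_mapping_eqI) (simp add: lookup_minus left_diff_distrib)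

lemma lie_rep_graded_map:
  assumes "\<And>m n i. of_int (n - m) * c (m + n) i = c n i * c m (n + i) - c m i * c n (m + i)"
  shows "lie_rep zscale witt_bracket zscale (graded_map c)"
proof -
  have "graded_map c (witt_bracket x y) v =
      graded_map c x (graded_map c y v) - graded_map c y (graded_map c x v)" for x y v
  proof (induction x rule: zvec_induct)
    case (bas m)
    show ?case
    proof (induction y rule: zvec_induct)
      case (bas n)
      show ?case
      proof (induction v rule: zvec_induct)
        case (bas i)
        have e: "bas (n + (m + i)) = bas (m + (n + i))" by (simp add: add.left_commute)
        show ?case
          using assms[of n m i]
          by (simp add: witt_bracket_def graded_map_bas graded_map_scale_left
                graded_map_scale_right zscale_simps zscale_diff_left e add.assoc mult.commute)
      qed (simp_all add: graded_map_add_right graded_map_scale_right zscale_simps)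
    qed (simp_all add: witt_bracket_def graded_map_add_left graded_map_add_right
           graded_map_scale_left graded_map_scale_right zscale_simps)
  qed (simp_all add: witt_bracket_def graded_map_add_left graded_map_add_right
         graded_map_scale_left graded_map_scale_right zscale_simps)
  then show ?thesis by (simp add: lie_rep_def bilinear_graded_map)
qed

lemma lie_rep_V_lower: "lie_rep zscale witt_bracket zscale (V_lower \<alpha>)"
  unfolding V_lower_def
  by (rule lie_rep_graded_map) (auto simp: algebra_simps add_eq_0_iff)

lemma lie_rep_V_upper: "lie_rep zscale witt_bracket zscale (V_upper \<beta>)"
  unfolding V_upper_def
proof (rule lie_rep_graded_map, goal_cases)
  case (1 m n i)
  show ?case
  proof (cases "i = - m - n")
    case True
    then show ?thesis
      by (cases "m = 0"; cases "n = 0") (simp_all add: True, simp_all add: algebra_simps)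
  next
    case False
    then show ?thesis by (auto simp: algebra_simps add_eq_0_iff)
  qed
qed

lemma lie_rep_V_two: "lie_rep zscale witt_bracket zscale (V_two \<alpha> \<beta>)"
  unfolding V_two_def
  by (rule lie_rep_graded_map) (simp add: algebra_simps)

lemma witt_bracket_commute: "witt_bracket y x = - witt_bracket x y"
proof (induction x rule: zvec_induct)
  case (bas m)
  show ?case
    by (induction y rule: zvec_induct)
      (auto simp: witt_bracket_def graded_map_bas graded_map_add_left graded_map_add_right
        graded_map_scale_left graded_map_scale_right add.commute lookup_add algebra_simps
        intro!: poly_mapping_eqI)
qed (auto simp: witt_bracket_def graded_map_add_left graded_map_add_right
       graded_map_scale_left graded_map_scale_right intro!: poly_mapping_eqI)

lemma lie_algebra_witt: "lie_algebra zscale witt_bracket"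
proof -
  have bil: "bilinear_map zscale zscale zscale witt_bracket"
    unfolding witt_bracket_def by (rule bilinear_graded_map)
  have alt: "witt_bracket x x = 0" for x
  proof (rule poly_mapping_eqI)
    fix k
    have "Poly_Mapping.lookup (witt_bracket x x) k = - Poly_Mapping.lookup (witt_bracket x x) k"
      by (metis witt_bracket_commute lookup_uminus)
    then show "Poly_Mapping.lookup (witt_bracket x x) k = Poly_Mapping.lookup 0 k" by simp
  qed
  have rep: "lie_rep zscale witt_bracket zscale witt_bracket"
    using lie_rep_graded_map[of "\<lambda>m n. of_int (n - m)"]
    by (simp add: witt_bracket_def algebra_simps)
  have neg: "witt_bracket (- x) y = - witt_bracket x y" for x y
    using bil by (metis bilinear_map_def Vector_Spaces.linear_def module_hom.neg)
  have "witt_bracket (witt_bracket x y) z + witt_bracket (witt_bracket y z) x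
      + witt_bracket (witt_bracket z x) y = 0" for x y z
  proof -
    have "witt_bracket (witt_bracket x y) z =
        witt_bracket x (witt_bracket y z) - witt_bracket y (witt_bracket x z)"
      using rep by (simp add: lie_rep_def)
    moreover have "witt_bracket (witt_bracket y z) x = - witt_bracket x (witt_bracket y z)"
      by (rule witt_bracket_commute)
    moreover have "witt_bracket (witt_bracket z x) y = witt_bracket y (witt_bracket x z)"
      using witt_bracket_commute[of z x] neg[of "witt_bracket x z" y]
        witt_bracket_commute[of "witt_bracket x z" y] by simp
    ultimately show ?thesis by simp
  qed
  then show ?thesis using bil alt by (simp add: lie_algebra_def)
qed

end

theory Submission
  imports Defs
begin

text \<open>
  Write \<open>c = - \<phi>\<close> and \<open>a = c(0,0)\<close>. The action of \<open>W\<^sub>0\<close> and the commutator condition force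
  \<open>c(0,n) = a + n\<close>, hence \<open>c(n,0) = a + 2n\<close>. Applying the representation identity to \<open>W\<^sub>0\<close> and
  combining it with the commutator condition then gives \<open>c(m,n) = a + n + 2m\<close> for \<open>m \<noteq> n\<close>, and one
  further instance of the identity settles the diagonal. So \<open>\<rho>\<close> is \<open>V_two a 2\<close>, in which \<open>a\<close> can be
  shifted by any integer. It is indecomposable because \<open>W\<^sub>0\<close> has simple spectrum, so that each
  basis vector lies in one of two complementary subrepresentations.
\<close>

section \<open>Graded bilinear maps and their coefficients\<close>

lemma zscale_bas_eq_iff [simp]: "zscale a (bas k) = zscale b (bas k) \<longleftrightarrow> a = b"
  by (auto simp: bas_def zscale_single dest: arg_cong[where f = "\<lambda>p. Poly_Mapping.lookup p k"])

lemma bilinear_map_eq_graded_map: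
  assumes "bilinear_map zscale zscale zscale \<rho>"
    and "\<And>m i. \<rho> (bas m) (bas i) = zscale (c m i) (bas (m + i))"
  shows "\<rho> = graded_map c"
proof (intro ext)
  fix x v
  have lin: "\<rho> (x + y) v = \<rho> x v + \<rho> y v" "\<rho> (zscale r x) v = zscale r (\<rho> x v)"
    "\<rho> x (v + w) = \<rho> x v + \<rho> x w" "\<rho> x (zscale r v) = zscale r (\<rho> x v)" for x y v w r
    using assms(1)
    by (auto simp: bilinear_map_def Vector_Spaces.linear_def module_hom_def module_hom_axioms_def)
  have zero: "\<rho> 0 v = 0" "\<rho> x 0 = 0" for x v
    using lin(1)[of 0 0 v] lin(3)[of x 0 0] by simp_all
  show "\<rho> x v = graded_map c x v"
  proof (induction x rule: zvec_induct)
    case (bas m)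
    show ?case
      by (induction v rule: zvec_induct)
        (simp_all add: zero lin assms(2) graded_map_bas graded_map_add_right graded_map_scale_right)
  qed (simp_all add: zero lin graded_map_add_left graded_map_scale_left)
qed

text \<open>\<open>bas m\<close> shifts degrees by \<open>m\<close>, so degree \<open>k\<close>
  receives only from \<open>k - m\<close>. For \<open>m = 0\<close> this says that
  \<open>bas 0\<close> acts diagonally.\<close>

lemma lookup_graded_map_bas:
  "Poly_Mapping.lookup (graded_map c (bas m) v) k = c m (k - m) * Poly_Mapping.lookup v (k - m)"
proof (induction v rule: zvec_induct)
  case (bas i)
  show ?case
    by (subst graded_map_bas, auto simp: bas_def lookup_single when_def)
qed (simp_all add: graded_map_add_right graded_map_scale_right lookup_add algebra_simps)

section \<open>Indecomposability from the spectrum of \<open>bas 0\<close>\<close>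

text \<open>The eigenvalues \<open>c 0 i\<close> of \<open>bas 0\<close> are distinct, so each
  eigenspace is a line. The components of \<open>bas i\<close> in \<open>U1\<close> and
  \<open>U2\<close> are killed by \<open>bas 0 - c 0 i\<close>, hence are multiples of
  \<open>bas i\<close>, and one of them is nonzero.\<close>

lemma bas_in_complementary_subrep:
  assumes inj: "inj (c 0)"
    and sub: "subrep zscale (graded_map c) U1" "subrep zscale (graded_map c) U2"
    and int: "U1 \<inter> U2 = {0}" and sum: "{u1 + u2 | u1 u2. u1 \<in> U1 \<and> u2 \<in> U2} = UNIV"
  shows "bas i \<in> U1 \<or> bas i \<in> U2"
proof -
  interpret vector_space zscale by (rule vector_space_zscale)
  have U: "subspace U1" "subspace U2" using sub by (auto simp: subrep_def)
  obtain u1 u2 where u: "u1 \<in> U1" "u2 \<in> U2" "bas i = u1 + u2" using sum by blast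
  \<comment> \<open>\<open>D\<close> preserves \<open>U1\<close> and \<open>U2\<close> and kills
    \<open>bas i\<close>, so \<open>D u1 = - D u2\<close> lies in their intersection.\<close>
  define D where "D v = graded_map c (bas 0) v - zscale (c 0 i) v" for v
  have "D u1 \<in> U1" "D u2 \<in> U2"
    using u sub U unfolding D_def by (auto simp: subrep_def intro: subspace_diff subspace_scale)
  moreover have D0: "D u1 + D u2 = 0"
  proof -
    have "D u1 + D u2 = D (bas i)"
      unfolding D_def u(3) by (simp add: graded_map_add_right zscale_simps)
    then show ?thesis by (simp add: D_def graded_map_bas)
  qed
  moreover have "D u1 = - D u2" using D0 by (simp add: eq_neg_iff_add_eq_0)
  ultimately have "D u1 \<in> U1 \<inter> U2" using U subspace_neg by auto
  then have "D u1 = 0" using int by simp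
  have "Poly_Mapping.lookup u1 k = 0" if "k \<noteq> i" for k
  proof -
    have "(c 0 k - c 0 i) * Poly_Mapping.lookup u1 k = Poly_Mapping.lookup (D u1) k"
      by (simp add: D_def lookup_minus lookup_graded_map_bas algebra_simps)
    then show ?thesis using \<open>D u1 = 0\<close> inj that by (auto dest: injD)
  qed
  then have u1: "u1 = zscale (Poly_Mapping.lookup u1 i) (bas i)"
    by (intro poly_mapping_eqI) (auto simp: bas_def lookup_single when_def)
  show ?thesis
  proof (cases "Poly_Mapping.lookup u1 i = 0")
    case True
    then have "u1 = 0" using u1 by simp
    then show ?thesis using u by simp
  next
    case False
    then have "bas i = zscale (inverse (Poly_Mapping.lookup u1 i)) u1"
      using u1 by (metis left_inverse scale_one zscale_simps(3))
    then show ?thesis using u(1) U(1) subspace_scale by metis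
  qed
qed

text \<open>Draw an edge from \<open>j\<close> to \<open>m + j\<close> when \<open>c m j\<close> is
  nonzero; \<open>conn\<close> says that every index is reachable from \<open>i\<close>. Nonzero
  coefficients can be divided out, so \<open>U\<close> contains every basis vector.\<close>

lemma subrep_graded_map_eq_UNIV:
  assumes sub: "subrep zscale (graded_map c) U" and i: "bas i \<in> U"
    and conn: "\<And>I. i \<in> I \<Longrightarrow> (\<And>j m. j \<in> I \<Longrightarrow> c m j \<noteq> 0 \<Longrightarrow> m + j \<in> I) \<Longrightarrow> I = UNIV"
  shows "U = UNIV"
proof -
  interpret vector_space zscale by (rule vector_space_zscale)
  have U: "subspace U" using sub by (simp add: subrep_def)
  have "{j. bas j \<in> U} = UNIV"
  proof (rule conn)
    fix j m assume j: "j \<in> {j. bas j \<in> U}" and c: "c m j \<noteq> 0"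
    have "zscale (c m j) (bas (m + j)) \<in> U"
      using sub j graded_map_bas[of c m j] by (metis subrep_def mem_Collect_eq)
    then have "zscale (inverse (c m j)) (zscale (c m j) (bas (m + j))) \<in> U"
      by (rule subspace_scale[OF U])
    then show "m + j \<in> {j. bas j \<in> U}" using c by simp
  qed (use i in simp)
  then have "x \<in> U" for x
    by (induction x rule: zvec_induct)
      (use U in \<open>auto intro: subspace_0 subspace_add subspace_scale\<close>)
  then show ?thesis by blast
qed

lemma indecomposable_graded_map:
  assumes inj: "inj (c 0)"
    and conn: "\<And>I. I \<noteq> {} \<Longrightarrow> (\<And>j m. j \<in> I \<Longrightarrow> c m j \<noteq> 0 \<Longrightarrow> m + j \<in> I) \<Longrightarrow> I = UNIV"
  shows "indecomposable_rep zscale (graded_map c)"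
  unfolding indecomposable_rep_def
proof (intro notI, elim exE conjE)
  fix U1 U2
  assume sub: "subrep zscale (graded_map c) U1" "subrep zscale (graded_map c) U2"
    and ne: "U1 \<noteq> UNIV" "U2 \<noteq> UNIV"
    and "U1 \<inter> U2 = {0}" "{u1 + u2 | u1 u2. u1 \<in> U1 \<and> u2 \<in> U2} = UNIV"
  then have "bas 0 \<in> U1 \<or> bas 0 \<in> U2" by (intro bas_in_complementary_subrep[of c, OF inj])
  moreover have "U = UNIV" if "subrep zscale (graded_map c) U" "bas 0 \<in> U" for U
    by (rule subrep_graded_map_eq_UNIV[OF that conn]) auto
  ultimately show False using sub ne by blast
qed

lemma indecomposable_V_two_2: "indecomposable_rep zscale (V_two \<alpha> 2)"
  unfolding V_two_def
proof (rule indecomposable_graded_map)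
  show "inj (\<lambda>i. \<alpha> + of_int i + of_int 0 * 2)" by (auto intro: injI)
next
  fix I :: "int set"
  assume ne: "I \<noteq> {}"
    and closed: "\<And>j m. j \<in> I \<Longrightarrow> \<alpha> + of_int j + of_int m * 2 \<noteq> 0 \<Longrightarrow> m + j \<in> I"
  \<comment> \<open>The move from \<open>j\<close> to \<open>k\<close> takes
    \<open>m = k - j\<close>, with coefficient \<open>\<alpha> + 2k - j\<close>. Thus each
    \<open>j\<close> misses at most one \<open>k\<close>, and each \<open>k\<close> is missed by at
    most one \<open>j\<close>.\<close>
  have step: "k \<in> I" if "j \<in> I" "\<alpha> + 2 * of_int k \<noteq> of_int j" for j k
    using closed[of j "k - j"] that by (auto simp: algebra_simps)
  obtain i where i: "i \<in> I" using ne by blast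
  have "k \<in> I" for k
  proof (cases "\<alpha> + 2 * of_int k = of_int i")
    case True
    \<comment> \<open>Only \<open>k\<close> is unreachable from \<open>i\<close> in one step, so a detour through another index works.\<close>
    define j where "j = (if i + 1 = k then i + 2 else i + 1)"
    have "j \<noteq> k" "j \<noteq> i" by (auto simp: j_def)
    have "\<alpha> + 2 * of_int j \<noteq> of_int i"
    proof
      assume "\<alpha> + 2 * of_int j = of_int i"
      then have "\<alpha> + 2 * of_int j = \<alpha> + 2 * of_int k" using True by simp
      then show False using \<open>j \<noteq> k\<close> by simp
    qed
    then have "j \<in> I" by (rule step[OF i])
    moreover have "\<alpha> + 2 * of_int k \<noteq> of_int j" using True \<open>j \<noteq> i\<close> by simp
    ultimately show ?thesis by (rule step)
  qed (use step[OF i] in blast)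
  then show "I = UNIV" by blast
qed

section \<open>Integer shifts of the parameter\<close>

lemma V_two_shift: "rep_isomorphic zscale (V_two (\<alpha> + of_int k) \<beta>) zscale (V_two \<alpha> \<beta>)"
proof -
  \<comment> \<open>\<open>map_key\<close> precomposes the coefficient function, so subtracting
    \<open>k\<close> sends \<open>bas i\<close> to \<open>bas (i + k)\<close>; \<open>g\<close> is
    the inverse.\<close>
  define f :: "zvec \<Rightarrow> zvec" where "f = Poly_Mapping.map_key (\<lambda>j. j - k)"
  define g :: "zvec \<Rightarrow> zvec" where "g = Poly_Mapping.map_key (\<lambda>j. j + k)"
  have inj: "inj (\<lambda>j. j - k)" "inj (\<lambda>j. j + k)" by (auto intro: injI)
  have lookup_f: "Poly_Mapping.lookup (f v) j = Poly_Mapping.lookup v (j - k)"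
    and lookup_g: "Poly_Mapping.lookup (g v) j = Poly_Mapping.lookup v (j + k)" for v j
    using inj by (simp_all add: f_def g_def map_key.rep_eq)
  have add: "f (v + w) = f v + f w" and scale: "f (zscale r v) = zscale r (f v)" for v w r
    by (simp_all add: poly_mapping_eq_iff fun_eq_iff lookup_f lookup_add)
  have f_bas: "f (bas i) = bas (i + k)" for i
    by (auto simp: poly_mapping_eq_iff fun_eq_iff lookup_f bas_def lookup_single when_def)
  have zero: "f 0 = 0" by (simp add: poly_mapping_eq_iff fun_eq_iff lookup_f)
  have "Vector_Spaces.linear zscale zscale f"
    using vector_space_zscale add scale
    by (simp add: Vector_Spaces.linear_def module_hom_def module_hom_axioms_def
        module_iff_vector_space)
  moreover have "bij f"
    by (rule o_bij[of g]) (simp_all add: poly_mapping_eq_iff fun_eq_iff lookup_f lookup_g)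
  moreover have "f (V_two (\<alpha> + of_int k) \<beta> x v) = V_two \<alpha> \<beta> x (f v)" for x v
  proof (induction x rule: zvec_induct)
    case (bas m)
    show ?case
      by (induction v rule: zvec_induct)
        (simp_all add: V_two_def zero add scale f_bas graded_map_bas graded_map_add_right
          graded_map_scale_right algebra_simps)
  qed (simp_all add: V_two_def zero add scale graded_map_add_left graded_map_scale_left)
  ultimately show ?thesis unfolding rep_isomorphic_def by blast
qed

section \<open>Solving for the coefficients\<close>

lemma anti_pre_lie_coeffs:
  fixes c :: "int \<Rightarrow> int \<Rightarrow> complex"
  assumes rep: "\<And>m n i. c n i * c m (n + i) - c m i * c n (m + i) = of_int (n - m) * c (m + n) i"
    and comm: "\<And>m n. c m n - c n m = of_int (m - n)"
  shows "c m n = c 0 0 + of_int n + of_int m * 2"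
proof -
  define a where "a = c 0 0"
  \<comment> \<open>\<open>bas n\<close> raises the eigenvalue of \<open>bas 0\<close> by
    \<open>n\<close> wherever it acts nontrivially.\<close>
  have wt: "c n i = 0 \<or> c 0 (n + i) = c 0 i + of_int n" for n i
  proof -
    have "c n i * (c 0 (n + i) - c 0 i - of_int n) = 0"
      using rep[of n i 0] by (simp add: algebra_simps)
    then have "c n i = 0 \<or> c 0 (n + i) - c 0 i - of_int n = 0"
      by (simp only: mult_eq_0_iff)
    then show ?thesis by (auto simp: algebra_simps)
  qed
  have c_n_0: "c n 0 = c 0 n + of_int n" for n
    using comm[of n 0] by (simp add: algebra_simps)
  have dich: "c 0 n = a + of_int n \<or> c 0 n = - of_int n" for n
    using wt[of n 0] c_n_0[of n] by (auto simp: a_def eq_neg_iff_add_eq_0)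
  have c_0_n: "c 0 n = a + of_int n" for n
  proof (rule ccontr)
    assume neq: "c 0 n \<noteq> a + of_int n"
    then have n: "c 0 n = - of_int n" using dich by blast
    \<comment> \<open>In the exceptional case, a nonzero \<open>c p n\<close> would give
      \<open>c 0 (p + n) = p - n\<close>, which fits neither alternative of
      \<open>dich\<close>.\<close>
    have zero: "c p n = 0" if "p \<noteq> 0" for p
    proof (rule ccontr)
      assume "c p n \<noteq> 0"
      then have eq: "c 0 (p + n) = of_int p - of_int n" using wt n by fastforce
      from dich[of "p + n"] show False
      proof
        assume "c 0 (p + n) = a + of_int (p + n)"
        then have "a + of_int n = - of_int n" using eq by (simp add: algebra_simps)
        then show False using neq n by simp
      next
        assume "c 0 (p + n) = - of_int (p + n)"
        then have "of_int p - of_int n = - (of_int p + of_int n :: complex)" using eq by simp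
        then have "2 * (of_int p :: complex) = 0" by algebra
        then show False using that by simp
      qed
    qed
    \<comment> \<open>The bracket of \<open>bas (-1)\<close> and \<open>bas 1\<close> is a nonzero
      multiple of \<open>bas 0\<close>, so \<open>bas 0\<close> kills \<open>bas n\<close> too. This
      forces \<open>n = 0\<close>, where \<open>c 0 0 = a\<close> contradicts
      \<open>neq\<close>.\<close>
    then have "c 0 n = 0" using rep[of 1 n "-1"] by simp
    then show False using n neq a_def by simp
  qed
  \<comment> \<open>Acting on \<open>bas 0\<close> gives a linear equation in \<open>c m n\<close>
    and \<open>c n m\<close>. Eliminating \<open>c n m\<close> by \<open>comm\<close> leaves the
    factor \<open>2 (n - m)\<close>, nonzero off the diagonal.\<close>
  have off: "c m n = a + of_int n + of_int m * 2" if "m \<noteq> n" for m n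
  proof -
    have "(a + 2 * of_int n) * c m n - (a + 2 * of_int m) * c n m
        = of_int (n - m) * (a + 2 * of_int (m + n))"
      using rep[of n 0 m] by (simp add: c_n_0 c_0_n algebra_simps)
    moreover have "c n m = c m n - of_int (m - n)" using comm[of m n] by (simp add: algebra_simps)
    ultimately have "2 * of_int (n - m) * (c m n - (a + of_int n + of_int m * 2)) = 0"
      by (simp add: algebra_simps)
    then show ?thesis using that by simp
  qed
  have "c m m = a + of_int m + of_int m * 2"
  proof -
    \<comment> \<open>The identity for \<open>n\<close> and \<open>m\<close> acting on
      \<open>bas m\<close> has \<open>c m m\<close> as its only diagonal coefficient if
      \<open>n\<close> avoids \<open>0\<close>, \<open>m\<close> and \<open>2 * m\<close>. Its
      factor \<open>c n (2 * m)\<close> is the last expression, which vanishes for finitely many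
      \<open>n\<close>.\<close>
    have "\<exists>n. n \<noteq> 0 \<and> n \<noteq> m \<and> n \<noteq> 2 * m \<and> a + 2 * of_int m + 2 * of_int n \<noteq> 0"
    proof -
      have "finite {n. a + 2 * of_int m + 2 * of_int n = 0}"
        by (rule finite_subset[OF _ finite_vimageI[of "{- a - 2 * of_int m}" "\<lambda>n. 2 * of_int n"]])
          (auto intro: injI simp: eq_diff_eq eq_neg_iff_add_eq_0 add_ac)
      then have "finite ({0, m, 2 * m} \<union> {n. a + 2 * of_int m + 2 * of_int n = 0})" by simp
      then obtain n where "n \<notin> {0, m, 2 * m} \<union> {n. a + 2 * of_int m + 2 * of_int n = 0}"
        using ex_new_if_finite[OF infinite_UNIV_int] by blast
      then show ?thesis by blast
    qed
    then obtain n where n: "n \<noteq> 0" "n \<noteq> m" "n \<noteq> 2 * m"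
      and nz: "a + 2 * of_int m + 2 * of_int n \<noteq> 0" by blast
    have "(c m m - (a + of_int m + of_int m * 2)) * (a + 2 * of_int m + 2 * of_int n) = 0"
      using rep[of n m m] n by (simp add: off algebra_simps)
    then show ?thesis using nz by simp
  qed
  with off show ?thesis unfolding a_def by (cases "m = n") auto
qed

section \<open>From the anti-pre-Lie structure to its coefficients\<close>

theorem proposition3p6:
  fixes circ :: "zvec \<Rightarrow> zvec \<Rightarrow> zvec"
    and \<phi> :: "int \<Rightarrow> int \<Rightarrow> complex"
    and \<rho> :: "zvec \<Rightarrow> zvec \<Rightarrow> zvec"
  assumes "anti_pre_lie_structure_on zscale witt_bracket circ"
    and "\<And>m n. circ (bas m) (bas n) = zscale (\<phi> m n) (bas (m + n))"
    and "bilinear_map zscale zscale zscale \<rho>"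
    and "\<And>m n. \<rho> (bas m) (bas n) = - circ (bas m) (bas n)"
  shows "lie_rep zscale witt_bracket zscale \<rho> \<and>
         indecomposable_rep zscale \<rho> \<and>
         ((\<exists>\<alpha>. rep_isomorphic zscale \<rho> zscale (V_lower \<alpha>)) \<or>
          (\<exists>\<beta>. rep_isomorphic zscale \<rho> zscale (V_upper \<beta>)) \<or>
          (\<exists>\<alpha> \<beta>. 0 \<le> Re \<alpha> \<and> Re \<alpha> < 1 \<and> rep_isomorphic zscale \<rho> zscale (V_two \<alpha> \<beta>)))"
proof -
  define c where "c m n = - \<phi> m n" for m n
  have neg: "zscale (- r) v = - zscale r v" for r v
    by (intro poly_mapping_eqI) simp
  have apl: "anti_pre_lie_algebra zscale circ" "witt_bracket x y = circ x y - circ y x" for x y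
    using assms(1) by (auto simp: anti_pre_lie_structure_on_def)
  have circ_graded: "circ = graded_map \<phi>"
    using apl(1) assms(2)
    by (intro bilinear_map_eq_graded_map) (auto simp: anti_pre_lie_algebra_def)
  have \<rho>_graded: "\<rho> = graded_map c"
    using assms(2-4) by (intro bilinear_map_eq_graded_map) (auto simp: c_def neg)
  have comm: "c m n - c n m = of_int (m - n)" for m n
  proof -
    have "of_int (n - m) = \<phi> m n - \<phi> n m"
      using apl(2)[of "bas m" "bas n"]
      by (simp add: witt_bracket_def circ_graded graded_map_bas zscale_diff_left
          add.commute[of n m])
    from arg_cong[OF this, of uminus] show ?thesis by (simp add: c_def)
  qed
  \<comment> \<open>The anti-pre-Lie identity carries the reversed bracket. Passing to
    \<open>c = - \<phi>\<close> keeps the quadratic terms and flips the linear one, which gives the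
    representation identity.\<close>
  have rep: "c n i * c m (n + i) - c m i * c n (m + i) = of_int (n - m) * c (m + n) i" for m n i
  proof -
    have "circ (bas m) (circ (bas n) (bas i)) - circ (bas n) (circ (bas m) (bas i))
        = circ (witt_bracket (bas n) (bas m)) (bas i)"
      using apl(1) unfolding anti_pre_lie_algebra_def apl(2) Let_def by blast
    then have "\<phi> n i * \<phi> m (n + i) - \<phi> m i * \<phi> n (m + i) = of_int (m - n) * \<phi> (m + n) i"
      by (simp add: circ_graded witt_bracket_def graded_map_bas graded_map_scale_left
          graded_map_scale_right zscale_simps zscale_diff_left add.left_commute[of n m i]
          add.commute[of n m] add.assoc)
    moreover have "of_int (n - m) * c (m + n) i = of_int (m - n) * \<phi> (m + n) i"
      by (simp add: c_def left_diff_distrib)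
    ultimately show ?thesis by (simp add: c_def)
  qed
  define a where "a = c 0 0"
  have \<rho>: "\<rho> = V_two a 2"
    unfolding \<rho>_graded V_two_def a_def
    by (intro arg_cong[where f = graded_map] ext anti_pre_lie_coeffs rep comm)
  \<comment> \<open>An integer shift brings the real part into \<open>[0, 1)\<close>.\<close>
  define \<alpha> where "\<alpha> = a - of_int \<lfloor>Re a\<rfloor>"
  have "rep_isomorphic zscale \<rho> zscale (V_two \<alpha> 2)"
    using V_two_shift[of \<alpha> "\<lfloor>Re a\<rfloor>" 2] by (simp add: \<rho> \<alpha>_def)
  moreover have "0 \<le> Re \<alpha>" "Re \<alpha> < 1"
    unfolding \<alpha>_def using floor_correct[of "Re a"] by (simp_all, linarith?)
  ultimately show ?thesis
    using lie_rep_V_two indecomposable_V_two_2 \<rho> by blast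
qed

end
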